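(* Let $y_1,\dots,y_n\in\mathbb{R}$ and let $\hat y_{j,-i}=\hat y_{j,-i}(x_i)\in\mathbb{R}$ for $j=1,\dots,J$, $i=1,\dots,n$. Let $$T=\Big(\sum_{i=1}^n\hat y_{l,-i}\,\hat y_{j,-i}\Big)_{l,j=1}^{J},\qquad c=\Big(\sum_{i=1}^n y_i\hat y_{1,-i},\dots,\sum_{i=1}^n y_i\hat y_{J,-i}\Big)',$$ with $T$ assumed invertible. Then the weights $\hat w=(\hat w_1,\dots,\hat w_J)'$ achieving $$\min_{w\in\mathbb{R}^J}\ \sum_{i=1}^n\Big(y_i-\sum_{j=1}^J w_j\hat y_{j,-i}(x_i)\Big)^2$$ are of the form $$\hat w=T^{-1}c .$$ In addition, if the $J$ predictors are orthonormal, i.e. $\sum_{i=1}^n\hat y_{l,-i}\hat y_{j,-i}$ equals $1$ if $l=j$ and $0$ otherwise, then $T=I$ and the solution becomes $$\hat w_j=\sum_{i=1}^n y_i\hat y_{j,-i},\qquad j=1,\dots,J .$$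
   Context: Here $y_i$ is the observed response at design point $x_i$ and $\hat y_{j,-i}(x_i)$ is the prediction at $x_i$ from the $j$-th of $J$ predictors fitted without the $i$-th data point; for the statement these are arbitrary given real numbers. No constraints are imposed on the weights. *)

theory Defs
  imports "HOL-Analysis.Analysis"
begin

text \<open>
  The finite index type of the \<open>J\<close> predictors is \<open>'j\<close>, so \<open>J = CARD('j)\<close>; the data points are
  indexed by \<open>{1..n}\<close>. The value \<open>yhat j i\<close> is the leave-one-out prediction of the response
  \<open>y i\<close> by the \<open>j\<close>-th predictor fitted without the \<open>i\<close>-th data point.
\<close>

definition stack_T :: "nat \<Rightarrow> ('j::finite \<Rightarrow> nat \<Rightarrow> real) \<Rightarrow> real^'j^'j" where
  "stack_T n yhat = (\<chi> l j. \<Sum>i=1..n. yhat l i * yhat j i)"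

definition stack_c :: "nat \<Rightarrow> (nat \<Rightarrow> real) \<Rightarrow> ('j::finite \<Rightarrow> nat \<Rightarrow> real) \<Rightarrow> real^'j" where
  "stack_c n y yhat = (\<chi> j. \<Sum>i=1..n. y i * yhat j i)"

definition stack_loss ::
    "nat \<Rightarrow> (nat \<Rightarrow> real) \<Rightarrow> ('j::finite \<Rightarrow> nat \<Rightarrow> real) \<Rightarrow> real^'j \<Rightarrow> real" where
  "stack_loss n y yhat w = (\<Sum>i=1..n. (y i - (\<Sum>j\<in>UNIV. w $ j * yhat j i))\<^sup>2)"

definition orthonormal_predictors :: "nat \<Rightarrow> ('j::finite \<Rightarrow> nat \<Rightarrow> real) \<Rightarrow> bool" where
  "orthonormal_predictors n yhat \<longleftrightarrow>
     (\<forall>l j. (\<Sum>i=1..n. yhat l i * yhat j i) = (if l = j then 1 else 0))"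

end

theory Submission
  imports Defs
begin

text \<open>
  Expanding the square turns the loss into \<open>w \<bullet> T w - 2 c \<bullet> w + (\<Sum>i=1..n. (y i)\<^sup>2)\<close>.
  Since \<open>v \<bullet> T w\<close> is the inner product of the combined predictions with weights \<open>v\<close> and \<open>w\<close>,
  the Gram matrix \<open>T\<close> is symmetric and positive semidefinite. Moving from \<open>w\<close> along
  \<open>r = T w - c\<close> changes such a quadratic to first order by \<open>2 (r \<bullet> r)\<close>, so its minimizers are
  exactly the solutions of \<open>T w = c\<close>.
\<close>

lemma quadratic_form_expand:
  fixes f :: "'a::real_inner \<Rightarrow> 'a"
  assumes "linear f" and selfadjoint: "\<And>x y. f x \<bullet> y = x \<bullet> f y"
  shows "(x + d) \<bullet> f (x + d) - 2 * (b \<bullet> (x + d))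
    = (x \<bullet> f x - 2 * (b \<bullet> x)) + 2 * ((f x - b) \<bullet> d) + d \<bullet> f d"
proof -
  have "x \<bullet> f d = f x \<bullet> d"
    by (rule selfadjoint[symmetric])
  moreover have "d \<bullet> f x = f x \<bullet> d"
    by (rule inner_commute)
  ultimately show ?thesis
    by (simp add: linear_add[OF \<open>linear f\<close>] inner_add inner_diff algebra_simps)
qed

lemma nonneg_quadratic_imp_linear_coeff_eq_0:
  fixes a b :: real
  assumes "\<And>t. 0 \<le> a * t\<^sup>2 + b * t"
  shows "b = 0"
proof (rule DERIV_local_min)
  show "((\<lambda>t. a * t\<^sup>2 + b * t) has_real_derivative b) (at 0)"
    by (auto intro!: derivative_eq_intros)
  show "\<forall>t. \<bar>0 - t\<bar> < 1 \<longrightarrow> a * 0\<^sup>2 + b * 0 \<le> a * t\<^sup>2 + b * t"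
    using assms by simp
qed simp

lemma is_arg_min_quadratic_iff:
  fixes f :: "'a::real_inner \<Rightarrow> 'a"
  assumes "linear f" and selfadjoint: "\<And>x y. f x \<bullet> y = x \<bullet> f y"
    and psd: "\<And>x. 0 \<le> x \<bullet> f x"
  shows "is_arg_min (\<lambda>x. x \<bullet> f x - 2 * (b \<bullet> x) + k) (\<lambda>_. True) x \<longleftrightarrow> f x = b"
    (is "is_arg_min ?q _ x \<longleftrightarrow> _")
proof -
  have expand: "?q (x + d) = ?q x + 2 * ((f x - b) \<bullet> d) + d \<bullet> f d" for d
    using quadratic_form_expand[OF \<open>linear f\<close> selfadjoint, of x d b] by simp
  show ?thesis
  proof
    assume minimal: "is_arg_min ?q (\<lambda>_. True) x"
    define r where "r = f x - b"
    have "0 \<le> (r \<bullet> f r) * t\<^sup>2 + (2 * (r \<bullet> r)) * t" for t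
    proof -
      have "?q x \<le> ?q (x + t *\<^sub>R r)"
        using minimal by (simp only: is_arg_min_linorder simp_thms)
      then have "0 \<le> 2 * (r \<bullet> (t *\<^sub>R r)) + (t *\<^sub>R r) \<bullet> f (t *\<^sub>R r)"
        unfolding expand r_def by simp
      then show ?thesis
        by (simp add: linear_scale[OF \<open>linear f\<close>] power2_eq_square algebra_simps)
    qed
    then have "2 * (r \<bullet> r) = 0"
      by (rule nonneg_quadratic_imp_linear_coeff_eq_0)
    then show "f x = b"
      by (simp add: r_def)
  next
    assume "f x = b"
    then have "?q x \<le> ?q y" for y
      using expand[of "y - x"] psd[of "y - x"] by simp
    then show "is_arg_min ?q (\<lambda>_. True) x"
      by (simp add: is_arg_min_linorder)
  qed
qed

lemma matrix_vector_mult_eq_iff_matrix_inv: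
  fixes A :: "'a::semiring_1^'n^'m"
  assumes "invertible A"
  shows "A *v x = b \<longleftrightarrow> x = matrix_inv A *v b"
proof -
  have "A ** matrix_inv A = mat 1" and "matrix_inv A ** A = mat 1"
    using someI_ex[OF assms[unfolded invertible_def]] by (simp_all add: matrix_inv_def)
  then show ?thesis
    by (auto simp: matrix_vector_mul_assoc)
qed

definition stack_pred :: "('j::finite \<Rightarrow> nat \<Rightarrow> real) \<Rightarrow> real^'j \<Rightarrow> nat \<Rightarrow> real" where
  "stack_pred yhat w i = (\<Sum>j\<in>UNIV. w $ j * yhat j i)"

lemma sum_mult_stack_pred:
  "(\<Sum>i\<in>I. a i * stack_pred yhat w i) = (\<Sum>j\<in>UNIV. w $ j * (\<Sum>i\<in>I. a i * yhat j i))"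
proof -
  have "(\<Sum>i\<in>I. a i * stack_pred yhat w i) = (\<Sum>i\<in>I. \<Sum>j\<in>UNIV. w $ j * (a i * yhat j i))"
    by (simp add: stack_pred_def sum_distrib_left mult_ac)
  also have "\<dots> = (\<Sum>j\<in>UNIV. \<Sum>i\<in>I. w $ j * (a i * yhat j i))"
    by (rule sum.swap)
  finally show ?thesis
    by (simp add: sum_distrib_left)
qed

lemma inner_stack_c:
  "stack_c n y yhat \<bullet> w = (\<Sum>i=1..n. y i * stack_pred yhat w i)"
  unfolding sum_mult_stack_pred by (simp add: stack_c_def inner_vec_def mult.commute)

lemma inner_stack_T_mult:
  "v \<bullet> (stack_T n yhat *v w) = (\<Sum>i=1..n. stack_pred yhat v i * stack_pred yhat w i)"
proof -
  have "(stack_T n yhat *v w) $ l = (\<Sum>i=1..n. stack_pred yhat w i * yhat l i)" for l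
    using sum_mult_stack_pred[of "yhat l" yhat w "{1..n}"]
    by (simp add: stack_T_def matrix_vector_mult_def mult.commute)
  then have "v \<bullet> (stack_T n yhat *v w) = (\<Sum>i=1..n. stack_pred yhat w i * stack_pred yhat v i)"
    by (simp add: inner_vec_def sum_mult_stack_pred)
  then show ?thesis
    by (simp add: mult.commute)
qed

lemma stack_loss_eq_quadratic:
  "stack_loss n y yhat w
    = w \<bullet> (stack_T n yhat *v w) - 2 * (stack_c n y yhat \<bullet> w) + (\<Sum>i=1..n. (y i)\<^sup>2)"
proof -
  have "stack_loss n y yhat w = (\<Sum>i=1..n. (y i - stack_pred yhat w i)\<^sup>2)"
    by (simp add: stack_loss_def stack_pred_def)
  also have "\<dots> = (\<Sum>i=1..n. stack_pred yhat w i * stack_pred yhat w i)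
      - 2 * (\<Sum>i=1..n. y i * stack_pred yhat w i) + (\<Sum>i=1..n. (y i)\<^sup>2)"
    by (simp add: power2_eq_square algebra_simps sum.distrib sum_subtractf sum_distrib_left)
  finally show ?thesis
    by (simp add: inner_stack_T_mult inner_stack_c)
qed

lemma is_arg_min_stack_loss_iff_normal_equations:
  "is_arg_min (stack_loss n y yhat) (\<lambda>_. True) w \<longleftrightarrow> stack_T n yhat *v w = stack_c n y yhat"
  unfolding stack_loss_eq_quadratic[abs_def]
proof (rule is_arg_min_quadratic_iff)
  show "linear ((*v) (stack_T n yhat))"
    by (rule matrix_vector_mul_linear)
  show "(stack_T n yhat *v u) \<bullet> v = u \<bullet> (stack_T n yhat *v v)" for u v
    by (simp add: inner_commute[of _ v] inner_stack_T_mult mult.commute)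
  show "0 \<le> v \<bullet> (stack_T n yhat *v v)" for v
    by (simp add: inner_stack_T_mult sum_nonneg)
qed

lemma stack_T_eq_mat_1_iff: "stack_T n yhat = mat 1 \<longleftrightarrow> orthonormal_predictors n yhat"
  by (simp add: orthonormal_predictors_def stack_T_def mat_def vec_eq_iff)

theorem theorem3p2:
  fixes n :: nat
    and y :: "nat \<Rightarrow> real"
    and yhat :: "'j::finite \<Rightarrow> nat \<Rightarrow> real"
  assumes "invertible (stack_T n yhat)"
  shows "(\<forall>w. is_arg_min (stack_loss n y yhat) (\<lambda>_. True) w \<longleftrightarrow>
            w = matrix_inv (stack_T n yhat) *v stack_c n y yhat) \<and>
         (orthonormal_predictors n yhat \<longrightarrow>
            stack_T n yhat = mat 1 \<and>
            (\<forall>w. is_arg_min (stack_loss n y yhat) (\<lambda>_. True) w \<longleftrightarrow>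
               (\<forall>j. w $ j = (\<Sum>i=1..n. y i * yhat j i))))"
proof (intro conjI impI allI)
  show "is_arg_min (stack_loss n y yhat) (\<lambda>_. True) w \<longleftrightarrow>
      w = matrix_inv (stack_T n yhat) *v stack_c n y yhat" for w
    unfolding is_arg_min_stack_loss_iff_normal_equations
    by (rule matrix_vector_mult_eq_iff_matrix_inv[OF assms])
next
  assume "orthonormal_predictors n yhat"
  then show T: "stack_T n yhat = mat 1"
    by (simp add: stack_T_eq_mat_1_iff)
  show "is_arg_min (stack_loss n y yhat) (\<lambda>_. True) w \<longleftrightarrow>
      (\<forall>j. w $ j = (\<Sum>i=1..n. y i * yhat j i))" for w
    by (simp add: is_arg_min_stack_loss_iff_normal_equations T stack_c_def vec_eq_iff)
qed

end
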